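(* Let $(X,d,\mu)$ be a geometrically doubling metric measure space. Then for all $f\in L^1_{loc}(\mu)$, $Mf(x)\ge|f|(x)$ for $\mu$-almost every $x$.
   Context: Closed balls are $B^{cl}(x,r):=\{y\in X: d(x,y)\le r\}$, $r>0$. Metric measure space: $(X,d)$ is a metric space and $\mu$ is a Borel measure (or the completion of one), not identically $0$, assigning finite measure to bounded Borel sets, and $\tau$-additive, meaning that for every collection $\{U_\alpha:\alpha\in\Lambda\}$ of open sets, $\mu(\cup_\alpha U_\alpha)=\sup \mu(\cup_{i=1}^n U_{\alpha_i})$, the supremum being over all finite subcollections. A metric space is geometrically doubling if there exists a positive integer $D$ such that every ball of radius $r$ (for every $r>0$) can be covered with no more than $D$ balls of radius $r/2$. $L^1_{loc}(\mu)$ is the set of measurable functions that are $\mu$-integrable on every ball. The centered Hardy-Littlewood maximal function is $$Mf(x):=\sup_{\{r>0:\ 0<\mu(B^{cl}(x,r))\}}\frac{1}{\mu(B^{cl}(x,r))}\int_{B^{cl}(x,r)}|f|\,d\mu.$$ *)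

theory Defs
  imports "HOL-Analysis.Analysis"
begin

text \<open>
  The metric space is the whole type, so every ball is a ball in the space and the underlying
  \<open>\<sigma>\<close>-algebra is that of the Borel sets of the metric topology, possibly completed.
\<close>

definition tau_additive :: "'a::topological_space measure \<Rightarrow> bool" where
  "tau_additive M \<longleftrightarrow>
     (\<forall>\<U>. (\<forall>U\<in>\<U>. open U) \<longrightarrow>
        emeasure M (\<Union>\<U>) = (SUP \<F>\<in>{\<F>. finite \<F> \<and> \<F> \<subseteq> \<U>}. emeasure M (\<Union>\<F>)))"

definition metric_measure_space :: "'a::metric_space measure \<Rightarrow> bool" where
  "metric_measure_space M \<longleftrightarrow>
     (\<exists>N. sets N = sets (borel :: 'a measure) \<and> (M = N \<or> M = completion N)) \<and>
     emeasure M (space M) \<noteq> 0 \<and>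
     (\<forall>A\<in>sets (borel :: 'a measure). bounded A \<longrightarrow> emeasure M A < \<infinity>) \<and>
     tau_additive M"

text \<open>
  All balls are closed. Using open balls instead gives an equivalent condition, with a
  possibly different constant. A family of at most \<open>D\<close> balls of radius \<open>r / 2\<close> is given by the
  set \<open>C\<close> of their centers.
\<close>

definition geometrically_doubling :: "'a::metric_space itself \<Rightarrow> bool" where
  "geometrically_doubling _ \<longleftrightarrow>
     (\<exists>D::nat. D > 0 \<and>
        (\<forall>(x::'a) r. r > 0 \<longrightarrow>
           (\<exists>C. finite C \<and> card C \<le> D \<and> cball x r \<subseteq> (\<Union>y\<in>C. cball y (r / 2)))))"

definition locally_integrable :: "'a::metric_space measure \<Rightarrow> ('a \<Rightarrow> real) \<Rightarrow> bool" where
  "locally_integrable M f \<longleftrightarrow>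
     f \<in> borel_measurable M \<and> (\<forall>x r. r > 0 \<longrightarrow> set_integrable M (cball x r) f)"

text \<open>The supremum may be infinite, so the maximal function takes values in \<open>[0, \<infinity>]\<close>.\<close>

definition maximal_function :: "'a::metric_space measure \<Rightarrow> ('a \<Rightarrow> real) \<Rightarrow> 'a \<Rightarrow> ennreal" where
  "maximal_function M f x =
     (SUP r\<in>{r. r > 0 \<and> 0 < emeasure M (cball x r)}.
        (\<integral>\<^sup>+y\<in>cball x r. ennreal \<bar>f y\<bar> \<partial>M) / emeasure M (cball x r))"

end

theory Submission
  imports Defs
begin

text \<open>
  The theorem reduces to a weak Lebesgue density statement: for a Borel set \<open>A\<close> and \<open>e > 0\<close>, almost
  every \<open>x \<in> A\<close> has some closed ball \<open>B\<close> with center \<open>x\<close> and \<open>\<mu> (B - A) < e \<mu> B\<close>. Applied to the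
  superlevel sets of \<open>\<bar>f\<bar>\<close>, this bounds the average of \<open>\<bar>f\<bar>\<close> over \<open>B\<close> from below.

  For the density statement let \<open>A\<close> be bounded and let \<open>U \<supseteq> A\<close> be open with \<open>\<mu> (U - A)\<close> small.
  Except for a subset of \<open>A\<close> of small measure, all points of \<open>A\<close> have distance at least \<open>r\<close> from
  the complement of \<open>U\<close>, for some \<open>r\<close>. Among the exceptional points of the density statement with
  this property take a maximal \<open>r\<close>-separated set. The balls of radius \<open>r\<close> around it cover all of
  these points, lie in \<open>U\<close>, and overlap at most \<open>D\<close> times, because a ball of radius \<open>r\<close> is covered
  by \<open>D\<close> balls of radius \<open>r / 2\<close>, each of which contains at most one point of the separated set.
  So their total measure is at most \<open>D \<mu> (U - A) / e\<close>.
\<close>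

section \<open>Regularity of Borel measures on metric spaces\<close>

text \<open>Induction over the sigma-algebra generated by the closed sets. Approximation from both
  sides carries the complement step, since complementation exchanges the roles of \<open>C\<close>
  and \<open>U\<close>.\<close>

lemma finite_measure_regular_closed_open:
  fixes M :: "'a::metric_space measure"
  assumes "finite_measure M" and sets: "sets M = sets borel"
    and "A \<in> sets borel" and "e > 0"
  shows "\<exists>C U. closed C \<and> open U \<and> C \<subseteq> A \<and> A \<subseteq> U \<and> measure M (U - C) < e"
proof -
  interpret finite_measure M by fact
  have [measurable]: "S \<in> sets M" if "open S" for S using that sets by auto
  have [measurable]: "S \<in> sets M" if "closed S" for S using that sets by auto
  have "A \<in> sigma_sets UNIV (Collect closed)"
    using assms(3) by (simp add: borel_eq_closed)
  then show ?thesis using \<open>e > 0\<close>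
  proof (induction arbitrary: e)
    case (Basic A)
    then have "closed A" by simp
    \<comment> \<open>A closed set is the intersection of its open neighborhoods of radius
      \<open>1 / real (Suc n)\<close>. By continuity from above one of them exceeds \<open>A\<close>
      by less than \<open>e\<close>, and \<open>A\<close> itself is the inner set.\<close>
    define V where "V n = (\<Union>x\<in>A. ball x (1 / real (Suc n)))" for n
    have V: "open (V n)" "A \<subseteq> V n" for n unfolding V_def by auto
    have dec: "decseq V"
    proof (rule decseq_SucI)
      fix n
      have "ball x (1 / real (Suc (Suc n))) \<subseteq> ball x (1 / real (Suc n))" for x :: 'a
        by (intro subset_ball) (simp add: field_simps)
      then show "V (Suc n) \<subseteq> V n" unfolding V_def by blast
    qed
    have "(\<Inter>n. V n) \<subseteq> A"
    proof
      fix y assume y: "y \<in> (\<Inter>n. V n)"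
      have "\<exists>x\<in>A. dist x y < d" if "d > 0" for d
      proof -
        obtain n where "1 / real (Suc n) < d" using nat_approx_posE \<open>d > 0\<close> by metis
        moreover have "\<exists>x\<in>A. dist x y < 1 / real (Suc n)" using y unfolding V_def by auto
        ultimately show ?thesis by (meson less_trans)
      qed
      then have "y \<in> closure A" by (simp add: closure_approachable)
      then show "y \<in> A" using \<open>closed A\<close> by simp
    qed
    then have "(\<Inter>n. V n) = A" using V by auto
    moreover have "(\<lambda>n. measure M (V n)) \<longlonglongrightarrow> measure M (\<Inter>n. V n)"
      using V dec by (intro finite_Lim_measure_decseq) auto
    ultimately have "(\<lambda>n. measure M (V n)) \<longlonglongrightarrow> measure M A" by simp
    then have "\<forall>\<^sub>F n in sequentially. measure M (V n) < measure M A + e"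
      using Basic.prems by (intro order_tendstoD(2)[where y = "measure M A"]) auto
    then obtain n where "measure M (V n) < measure M A + e"
      using eventually_happens by fastforce
    moreover have "measure M (V n - A) = measure M (V n) - measure M A"
      using V \<open>closed A\<close> by (intro finite_measure_Diff) auto
    ultimately show ?case using V \<open>closed A\<close> by (intro exI[of _ A] exI[of _ "V n"]) auto
  next
    case Empty
    then show ?case by (intro exI[of _ "{}"]) auto
  next
    case (Compl A)
    from Compl.IH[OF Compl.prems] obtain C U where
      "closed C" "open U" "C \<subseteq> A" "A \<subseteq> U" "measure M (U - C) < e" by (elim exE conjE)
    moreover have "- C - - U = U - C" by auto
    ultimately show ?case
      by (intro exI[of _ "- U"] exI[of _ "- C"]) auto
  next
    case (Union A)
    \<comment> \<open>The errors sum to \<open>e / 2\<close>. The other half pays for cutting the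
      union of the closed sets, which need not be closed, down to a finite subunion.\<close>
    have "\<exists>C U. closed C \<and> open U \<and> C \<subseteq> A n \<and> A n \<subseteq> U \<and> measure M (U - C) < e / 4 * (1/2) ^ n"
      for n using Union.IH[of "e / 4 * (1/2) ^ n" n] \<open>e > 0\<close> by simp
    then obtain C U where CU: "\<And>n. closed (C n)" "\<And>n. open (U n)" "\<And>n. C n \<subseteq> A n"
      "\<And>n. A n \<subseteq> U n" "\<And>n. measure M (U n - C n) < e / 4 * (1/2) ^ n" by metis
    have sums: "(\<lambda>n. e / 4 * (1/2) ^ n) sums (e / 2)"
      using sums_mult[OF geometric_sums[of "1/2::real"], of "e / 4"] by simp
    have summ: "summable (\<lambda>n. measure M (U n - C n))"
      using CU(5) by (intro summable_comparison_test'[OF sums_summable[OF sums], of 0])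
        (auto intro: less_imp_le)
    have *: "measure M (\<Union>n. U n - C n) \<le> e / 2"
    proof -
      have "measure M (\<Union>n. U n - C n) \<le> (\<Sum>n. measure M (U n - C n))"
        using CU(1,2) summ by (intro finite_measure_subadditive_countably) auto
      also have "\<dots> \<le> (\<Sum>n. e / 4 * (1/2) ^ n)"
        using CU(5) summ sums by (intro suminf_le) (auto intro: less_imp_le sums_summable)
      finally show ?thesis using sums by (simp add: sums_iff)
    qed
    have "(\<lambda>n. measure M (\<Union>i\<le>n. C i)) \<longlonglongrightarrow> measure M (\<Union>n. \<Union>i\<le>n. C i)"
      using CU(1) by (intro finite_Lim_measure_incseq) (auto simp: incseq_def intro: order_trans)
    moreover have "(\<Union>n. \<Union>i\<le>n. C i) = (\<Union>n. C n)" by auto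
    ultimately have "(\<lambda>n. measure M (\<Union>i\<le>n. C i)) \<longlonglongrightarrow> measure M (\<Union>n. C n)" by simp
    then have "\<forall>\<^sub>F n in sequentially. measure M (\<Union>n. C n) - e / 2 < measure M (\<Union>i\<le>n. C i)"
      using \<open>e > 0\<close> by (intro order_tendstoD(1)[where y = "measure M (\<Union>n. C n)"]) auto
    then obtain n where n: "measure M (\<Union>n. C n) - e / 2 < measure M (\<Union>i\<le>n. C i)"
      using eventually_happens by fastforce
    let ?C = "\<Union>i\<le>n. C i" and ?U = "\<Union>n. U n"
    have cl: "closed ?C" using CU(1) by auto
    have [measurable]: "(\<Union>n. C n) \<in> sets M" using CU(1) by auto
    have "measure M (?U - ?C) \<le> measure M ((\<Union>n. U n - C n) \<union> ((\<Union>n. C n) - ?C))"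
      using CU(1,2) cl by (intro finite_measure_mono sets.Un sets.Diff) auto
    also have "\<dots> \<le> measure M (\<Union>n. U n - C n) + measure M ((\<Union>n. C n) - ?C)"
      using CU(1,2) cl by (intro measure_subadditive) auto
    also have "measure M ((\<Union>n. C n) - ?C) = measure M (\<Union>n. C n) - measure M ?C"
      using cl by (intro finite_measure_Diff) auto
    finally have "measure M (?U - ?C) < e" using * n by simp
    moreover have "?C \<subseteq> (\<Union>n. A n)" "(\<Union>n. A n) \<subseteq> ?U" using CU(3,4) by blast+
    ultimately show ?case using cl CU(2)
      by (intro exI[of _ ?C] exI[of _ ?U]) auto
  qed
qed

text \<open>The measure need not be finite, so the previous lemma is applied to its restriction
  \<open>N\<close> to an open ball containing \<open>A\<close>. Intersecting \<open>U\<close> with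
  that ball keeps it open and makes it bounded.\<close>

lemma bounded_borel_outer_regular:
  fixes M :: "'a::metric_space measure"
  assumes sets: "sets M = sets borel" and fin: "\<And>x r. emeasure M (cball x r) < \<infinity>"
    and A: "A \<in> sets borel" "bounded A" and "e > 0"
  shows "\<exists>U. open U \<and> bounded U \<and> A \<subseteq> U \<and> measure M (U - A) < e"
proof -
  obtain x r where Ab: "A \<subseteq> ball x r"
    using A(2) bounded_subset_ballD by blast
  define N where "N = density M (indicator (ball x r))"
  have [measurable]: "ball x r \<in> sets M" using sets by simp
  have N: "emeasure N S = emeasure M (S \<inter> ball x r)" if "S \<in> sets borel" for S
    using that sets unfolding N_def
    by (subst emeasure_density) (auto simp: indicator_inter_arith[symmetric] ac_simps)
  have fb: "emeasure M (ball x r) < \<infinity>"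
    using emeasure_mono[of "ball x r" "cball x r" M] fin[of x r] sets by (auto intro: le_less_trans)
  have "space M = UNIV" using sets_eq_imp_space_eq[OF sets] by simp
  then have "finite_measure N"
    using N[of UNIV] fb by (intro finite_measureI) (auto simp: N_def)
  moreover have "sets N = sets borel" using sets by (simp add: N_def)
  ultimately have "\<exists>C U. closed C \<and> open U \<and> C \<subseteq> A \<and> A \<subseteq> U \<and> measure N (U - C) < e"
    using A(1) \<open>e > 0\<close> by (rule finite_measure_regular_closed_open)
  then obtain C U where CU: "closed C" "open U" "C \<subseteq> A" "A \<subseteq> U" "measure N (U - C) < e"
    by (elim exE conjE)
  have "measure M (U \<inter> ball x r - A) \<le> measure M ((U - C) \<inter> ball x r)"
  proof (rule measure_mono_fmeasurable)
    have "ball x r \<in> fmeasurable M" using fb sets by (simp add: fmeasurable_def)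
    then show "(U - C) \<inter> ball x r \<in> fmeasurable M"
      by (rule fmeasurableI2) (use CU(1,2) sets in auto)
  qed (use CU A sets in auto)
  also have "\<dots> = measure N (U - C)"
    using N[of "U - C"] CU(1,2) by (simp add: measure_def)
  finally show ?thesis using CU Ab
    by (intro exI[of _ "U \<inter> ball x r"]) (auto intro: bounded_subset[of "ball x r"])
qed

section \<open>Overlap counts and separated sets\<close>

text \<open>At each \<open>y\<close> the sum of the indicators of the \<open>B i\<close> counts the
  sets containing \<open>y\<close>, hence is at most \<open>D\<close> times the indicator of
  \<open>V\<close>. Integrating this gives the bound.\<close>

lemma sum_measure_le_overlap:
  assumes "finite I" and B: "\<And>i. i \<in> I \<Longrightarrow> B i \<in> sets M" "\<And>i. i \<in> I \<Longrightarrow> B i \<subseteq> V"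
    and V: "V \<in> fmeasurable M" and overlap: "\<And>y. card {i \<in> I. y \<in> B i} \<le> D"
  shows "(\<Sum>i\<in>I. measure M (B i)) \<le> real D * measure M V"
proof -
  have Bf: "B i \<in> fmeasurable M" if "i \<in> I" for i
    using fmeasurableI2[OF V B(2)[OF that] B(1)[OF that]] .
  have int: "integrable M (indicat_real (B i))" if "i \<in> I" for i
    using Bf[OF that] by (simp add: fmeasurable_def)
  have "(\<Sum>i\<in>I. measure M (B i)) = (\<Sum>i\<in>I. integral\<^sup>L M (indicat_real (B i)))"
    using Bf by (intro sum.cong) (auto simp: fmeasurable_def Int_absorb2 sets.sets_into_space)
  also have "\<dots> = integral\<^sup>L M (\<lambda>y. \<Sum>i\<in>I. indicat_real (B i) y)"
    using int by simp
  also have "\<dots> \<le> integral\<^sup>L M (\<lambda>y. real D * indicat_real V y)"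
  proof (rule integral_mono)
    fix y
    have "(\<Sum>i\<in>I. indicat_real (B i) y) = real (card {i \<in> I. y \<in> B i})"
      using \<open>finite I\<close> by (simp add: indicator_def sum.If_cases Int_def)
    moreover have "{i \<in> I. y \<in> B i} = {}" if "y \<notin> V" using B(2) that by auto
    ultimately show "(\<Sum>i\<in>I. indicat_real (B i) y) \<le> real D * indicat_real V y"
      using overlap[of y] by (cases "y \<in> V") auto
  qed (use int V in \<open>auto simp: fmeasurable_def\<close>)
  also have "\<dots> = real D * measure M V"
    using V by (simp add: fmeasurable_def Int_absorb2 sets.sets_into_space)
  finally show ?thesis .
qed

text \<open>Two points in one ball of radius \<open>r / 2\<close> are at distance at most
  \<open>r\<close>, so sending each point of \<open>T\<close> to the center of a ball containing it
  is injective.\<close>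

lemma card_le_of_separated_cover:
  assumes "finite C" and "T \<subseteq> (\<Union>y\<in>C. cball y (r / 2))"
    and "pairwise (\<lambda>x y. r < dist x y) T"
  shows "finite T \<and> card T \<le> card C"
proof -
  have "\<forall>x\<in>T. \<exists>y\<in>C. dist y x \<le> r / 2" using assms(2) by fastforce
  then obtain g where g: "\<And>x. x \<in> T \<Longrightarrow> g x \<in> C \<and> dist (g x) x \<le> r / 2" by metis
  have "inj_on g T"
  proof (rule inj_onI, rule ccontr)
    fix x y assume "x \<in> T" "y \<in> T" "g x = g y" "x \<noteq> y"
    then show False
      using g[of x] g[of y] pairwiseD[OF assms(3), of x y] dist_triangle3[of x y "g x"] by auto
  qed
  moreover have "g ` T \<subseteq> C" using g by auto
  ultimately show ?thesis
    using assms(1) card_inj_on_le inj_on_finite by blast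
qed

section \<open>Covering consequences of doubling\<close>

context
  fixes D :: nat
  assumes doubling: "\<And>(x::'a::metric_space) r. r > 0 \<Longrightarrow>
    \<exists>C. finite C \<and> card C \<le> D \<and> cball x r \<subseteq> (\<Union>y\<in>C. cball y (r / 2))"
begin

text \<open>Repeated halving reaches arbitrarily large ratios of radii, which makes bounded sets
  totally bounded.\<close>

lemma doubling_iterate:
  fixes x :: 'a
  assumes "s > 0"
  shows "\<exists>C. finite C \<and> card C \<le> D ^ k \<and> cball x (2 ^ k * s) \<subseteq> (\<Union>y\<in>C. cball y s)"
proof (induction k arbitrary: x)
  case 0
  show ?case by (intro exI[of _ "{x}"]) auto
next
  case (Suc k)
  obtain C where C: "finite C" "card C \<le> D" "cball x (2 ^ Suc k * s) \<subseteq> (\<Union>y\<in>C. cball y (2 ^ k * s))"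
    using doubling[of "2 ^ Suc k * s" x] \<open>s > 0\<close> by auto
  have "\<forall>y::'a. \<exists>E. finite E \<and> card E \<le> D ^ k \<and> cball y (2 ^ k * s) \<subseteq> (\<Union>z\<in>E. cball z s)"
    using Suc.IH by (rule allI)
  then obtain E :: "'a \<Rightarrow> 'a set" where E: "\<And>y. finite (E y)" "\<And>y. card (E y) \<le> D ^ k"
    "\<And>y. cball y (2 ^ k * s) \<subseteq> (\<Union>z\<in>E y. cball z s)" by metis
  have "card (\<Union>y\<in>C. E y) \<le> (\<Sum>y\<in>C. card (E y))" using C(1) by (rule card_UN_le)
  also have "\<dots> \<le> card C * D ^ k" using sum_bounded_above[of C "\<lambda>y. card (E y)"] E(2) by simp
  also have "\<dots> \<le> D ^ Suc k" using C(2) by simp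
  finally have "card (\<Union>y\<in>C. E y) \<le> D ^ Suc k" .
  moreover have "cball x (2 ^ Suc k * s) \<subseteq> (\<Union>z\<in>(\<Union>y\<in>C. E y). cball z s)"
    using C(3) E(3) by blast
  ultimately show ?case using C(1) E(1) by blast
qed

text \<open>A finite cover of \<open>S\<close> by balls of radius \<open>r / 2\<close> bounds the
  size of separated subsets, so one of largest cardinality exists. A point of \<open>S\<close> left
  uncovered by its balls of radius \<open>r\<close> could be added to it.\<close>

lemma bounded_maximal_separated:
  fixes S :: "'a set"
  assumes "bounded S" "r > 0"
  shows "\<exists>T\<subseteq>S. finite T \<and> pairwise (\<lambda>x y. r < dist x y) T \<and> S \<subseteq> (\<Union>x\<in>T. cball x r)"
proof -
  obtain x R where SR: "S \<subseteq> cball x R"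
    using bounded_subset_ballD[OF assms(1)] ball_subset_cball by (metis order_trans)
  obtain k where "R / (r / 2) < 2 ^ k" using real_arch_pow[of 2 "R / (r / 2)"] by auto
  then have "R \<le> 2 ^ k * (r / 2)" using \<open>r > 0\<close> by (simp add: field_simps)
  then have S: "S \<subseteq> cball x (2 ^ k * (r / 2))" using SR by auto
  obtain C where C: "finite C" "cball x (2 ^ k * (r / 2)) \<subseteq> (\<Union>y\<in>C. cball y (r / 2))"
    using doubling_iterate[of "r / 2" k x] \<open>r > 0\<close> by auto
  let ?P = "\<lambda>T. T \<subseteq> S \<and> pairwise (\<lambda>x y. r < dist x y) T"
  have bd: "finite T \<and> card T \<le> card C" if "?P T" for T
    using that S C by (intro card_le_of_separated_cover) auto
  have "?P {}" by simp
  moreover have "\<forall>T. ?P T \<longrightarrow> card T < Suc (card C)" using bd by (simp add: less_Suc_eq_le)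
  ultimately have "\<exists>T. ?P T \<and> (\<forall>T'. ?P T' \<longrightarrow> card T' \<le> card T)" by (rule ex_has_greatest_nat)
  then obtain T where T: "?P T" "\<And>T'. ?P T' \<Longrightarrow> card T' \<le> card T" by (elim exE conjE) simp
  have "S \<subseteq> (\<Union>x\<in>T. cball x r)"
  proof (rule ccontr)
    assume "\<not> ?thesis"
    then obtain y where y: "y \<in> S" "\<And>x. x \<in> T \<Longrightarrow> r < dist x y"
      by (fastforce simp: not_le)
    have "?P (insert y T)"
      using T(1) y by (auto simp: pairwise_insert dist_commute)
    moreover have "y \<notin> T" using y(2)[of y] \<open>r > 0\<close> by auto
    ultimately show False using T(2)[of "insert y T"] bd[OF T(1)] by simp
  qed
  then show ?thesis using T(1) bd by blast
qed

text \<open>By symmetry of the distance the centers counted here all lie in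
  \<open>cball y r\<close>, where the cover by half-size balls limits their number.\<close>

lemma separated_overlap:
  fixes T :: "'a set"
  assumes "r > 0" and "pairwise (\<lambda>x y. r < dist x y) T"
  shows "card {x \<in> T. y \<in> cball x r} \<le> D"
proof -
  obtain C where C: "finite C" "card C \<le> D" "cball y r \<subseteq> (\<Union>y\<in>C. cball y (r / 2))"
    using doubling[OF \<open>r > 0\<close>] by blast
  have "card {x \<in> T. y \<in> cball x r} \<le> card C"
    using C assms(2)
    by (intro card_le_of_separated_cover[THEN conjunct2, of _ _ r])
      (auto simp: dist_commute subset_iff intro: pairwise_subset)
  then show ?thesis using C(2) by simp
qed

section \<open>The weak density statement\<close>

text \<open>Only one good radius per point is asked for, so a point of \<open>Z\<close> is bad at
  every radius. Hence all balls in the covering argument can share a single radius.\<close>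

lemma weak_density_bounded:
  fixes M :: "'a measure"
  assumes sets: "sets M = sets borel" and fin: "\<And>x r. emeasure M (cball x r) < \<infinity>"
    and A: "A \<in> sets borel" "bounded A" and "e > 0"
  shows "AE x in M. x \<in> A \<longrightarrow> (\<exists>r>0. measure M (cball x r - A) < e * measure M (cball x r))"
proof -
  define Z where
    "Z = {x \<in> A. \<not> (\<exists>r>0. measure M (cball x r - A) < e * measure M (cball x r))}"
  have bfm: "S \<in> fmeasurable M" if "S \<in> sets borel" "bounded S" for S
  proof -
    obtain x r where "S \<subseteq> cball x r"
      using bounded_subset_ballD[OF \<open>bounded S\<close>] ball_subset_cball by (metis order_trans)
    have "cball x r \<in> fmeasurable M" using fin[of x r] sets by (simp add: fmeasurable_def)
    then show ?thesis
      by (rule fmeasurableI2) (use \<open>S \<subseteq> cball x r\<close> that sets in auto)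
  qed
  \<comment> \<open>Measurability of \<open>Z\<close> is not established; instead \<open>Z\<close>
    is enclosed in measurable sets of arbitrarily small measure.\<close>
  have *: "\<exists>Y\<in>fmeasurable M. Z \<subseteq> Y \<and> measure M Y \<le> d" if "d > 0" for d
  proof -
    \<comment> \<open>There are two errors: less than \<open>d'\<close> from the points of
      \<open>A\<close> too close to the complement of \<open>U\<close>, and at most
      \<open>D * d' / e\<close> from the balls. This choice makes them add up to
      \<open>d\<close>.\<close>
    define d' where "d' = d / (1 + real D / e)"
    have "1 + real D / e > 0" using \<open>e > 0\<close> by (simp add: add_pos_nonneg)
    then have "d' > 0" "d' * (1 + real D / e) = d"
      using \<open>d > 0\<close> unfolding d'_def by simp_all
    then have d': "d' > 0" "d' + real D * d' / e = d" by (simp_all add: algebra_simps)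
    obtain U where U: "open U" "bounded U" "A \<subseteq> U" "measure M (U - A) < d'"
      using bounded_borel_outer_regular[OF sets fin A d'(1)] by blast
    \<comment> \<open>Since \<open>infdist x {} = 0\<close>, the case where \<open>U\<close> is the
      whole space must be exempted from the distance condition.\<close>
    define K where "K n = {x \<in> U. - U \<noteq> {} \<longrightarrow> 1 / real (Suc n) < infdist x (- U)}" for n
    have K_borel: "open (K n)" for n
    proof -
      have "open {x. 1 / real (Suc n) < infdist x (- U)}"
        by (intro open_Collect_less continuous_intros)
      moreover have "K n = (if - U = {} then U else U \<inter> {x. 1 / real (Suc n) < infdist x (- U)})"
        by (auto simp: K_def)
      ultimately show ?thesis using U(1) by auto
    qed
    have K_ball: "cball x (1 / real (Suc n)) \<subseteq> U" if "x \<in> K n" for x n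
    proof
      fix y assume y: "y \<in> cball x (1 / real (Suc n))"
      show "y \<in> U"
      proof (rule ccontr)
        assume "y \<notin> U"
        then have "infdist x (- U) \<le> dist x y" by (intro infdist_le) auto
        then show False using y \<open>x \<in> K n\<close> \<open>y \<notin> U\<close> by (auto simp: K_def)
      qed
    qed
    have "decseq (\<lambda>n. A - K n)"
    proof (rule decseq_SucI)
      fix n
      have "1 / real (Suc (Suc n)) < 1 / real (Suc n)" by (simp add: field_simps)
      then show "A - K (Suc n) \<subseteq> A - K n" by (auto simp: K_def)
    qed
    moreover have "(\<Inter>n. A - K n) = {}"
    proof -
      have "\<exists>n. x \<in> K n" if "x \<in> A" for x
      proof (cases "- U = {}")
        case True
        then show ?thesis by (auto simp: K_def)
      next
        case False
        have "x \<notin> - U" using \<open>x \<in> A\<close> U(3) by auto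
        then have "infdist x (- U) > 0"
          using False U(1) in_closed_iff_infdist_zero[of "- U" x] infdist_nonneg[of x "- U"]
          by (auto simp: less_le)
        then obtain n where "1 / real (Suc n) < infdist x (- U)" using nat_approx_posE by metis
        then show ?thesis using \<open>x \<in> A\<close> U(3) by (auto simp: K_def)
      qed
      then show ?thesis by blast
    qed
    moreover have "A - K n \<in> fmeasurable M" for n
      using A K_borel by (intro bfm) (auto intro: bounded_subset)
    ultimately have "(\<lambda>n. measure M (A - K n)) \<longlonglongrightarrow> measure M {}"
      using Lim_measure_decseq[of "\<lambda>n. A - K n" M]
      by (simp add: fmeasurable_def top.not_eq_extremum image_subset_iff del: INT_simps)
    then have "\<forall>\<^sub>F n in sequentially. measure M (A - K n) < d'"
      using d'(1) by (intro order_tendstoD(2)[where y = "measure M {}"]) auto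
    then obtain n where n: "measure M (A - K n) < d'"
      using eventually_happens by fastforce
    define r where "r = 1 / real (Suc n)"
    have "r > 0" by (simp add: r_def)
    have "bounded (Z \<inter> K n)" using A(2) by (rule bounded_subset) (auto simp: Z_def)
    from bounded_maximal_separated[OF this \<open>r > 0\<close>] obtain T where
      T: "T \<subseteq> Z \<inter> K n" "finite T" "pairwise (\<lambda>x y. r < dist x y) T"
      "Z \<inter> K n \<subseteq> (\<Union>x\<in>T. cball x r)" by (elim exE conjE)
    have "e * measure M (\<Union>x\<in>T. cball x r) \<le> e * (\<Sum>x\<in>T. measure M (cball x r))"
      using T(2) \<open>e > 0\<close> sets by (intro mult_left_mono measure_UNION_le) auto
    \<comment> \<open>The radius \<open>r\<close> is bad at each point of \<open>T\<close>, which
      trades the measure of a ball for that of its part outside \<open>A\<close>. All these parts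
      lie in the small set \<open>U - A\<close>.\<close>
    also have "\<dots> \<le> (\<Sum>x\<in>T. measure M (cball x r - A))"
      unfolding sum_distrib_left using T(1) \<open>r > 0\<close> by (intro sum_mono leI) (auto simp: Z_def)
    also have "\<dots> \<le> real D * measure M (U - A)"
    proof (rule sum_measure_le_overlap[OF T(2)])
      fix y
      have "card {x \<in> T. y \<in> cball x r - A} \<le> card {x \<in> T. y \<in> cball x r}"
        using T(2) by (intro card_mono) auto
      then show "card {x \<in> T. y \<in> cball x r - A} \<le> D"
        using separated_overlap[OF \<open>r > 0\<close> T(3), of y] by simp
    next
      fix x assume "x \<in> T"
      then show "cball x r - A \<subseteq> U - A" using K_ball T(1) by (auto simp: r_def)
    qed (use A U sets in \<open>auto intro!: bfm intro: bounded_subset\<close>)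
    also have "\<dots> \<le> real D * d'" using U(4) by (intro mult_left_mono) auto
    finally have "measure M (\<Union>x\<in>T. cball x r) \<le> real D * d' / e"
      using \<open>e > 0\<close> by (simp add: field_simps)
    moreover have fm: "A - K n \<in> fmeasurable M" "(\<Union>x\<in>T. cball x r) \<in> fmeasurable M"
      using A K_borel T(2) by (auto intro!: bfm intro: bounded_subset)
    ultimately have "measure M ((A - K n) \<union> (\<Union>x\<in>T. cball x r)) \<le> d"
      using measure_Un_le[of "A - K n" M "\<Union>x\<in>T. cball x r"] n d'(2) by (auto simp: fmeasurable_def)
    moreover have "Z \<subseteq> (A - K n) \<union> (\<Union>x\<in>T. cball x r)" using T(4) by (auto simp: Z_def)
    ultimately show ?thesis using fm by (intro bexI[of _ "(A - K n) \<union> (\<Union>x\<in>T. cball x r)"]) auto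
  qed
  have "\<exists>Y\<in>null_sets M. Z \<subseteq> Y"
  proof -
    have "\<exists>Y\<in>fmeasurable M. Z \<subseteq> Y \<and> measure M Y \<le> 1 / real (Suc n)" for n
      by (rule *) simp
    then obtain Y where Y: "\<And>n. Y n \<in> fmeasurable M" "\<And>n. Z \<subseteq> Y n"
      "\<And>n. measure M (Y n) \<le> 1 / real (Suc n)" by metis
    have I: "(\<Inter>n. Y n) \<in> fmeasurable M"
      by (rule fmeasurableI2[OF Y(1)[of 0]])
        (use Y(1) in \<open>auto simp: fmeasurable_def\<close>)
    have "measure M (\<Inter>n. Y n) \<le> 1 / real (Suc n)" for n
      using measure_mono_fmeasurable[of "\<Inter>n. Y n" "Y n" M] Y I by (force intro: order_trans)
    then have "measure M (\<Inter>n. Y n) = 0"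
      by (metis nat_approx_posE not_le measure_nonneg less_le)
    then have "(\<Inter>n. Y n) \<in> null_sets M"
      using I by (auto simp: emeasure_eq_measure2 null_sets_def)
    then show ?thesis using Y(2) by blast
  qed
  then obtain Y where "Y \<in> null_sets M" "Z \<subseteq> Y" by blast
  then show ?thesis by (intro AE_I'[of Y]) (auto simp: Z_def)
qed

text \<open>Countably many bounded pieces exhaust \<open>A\<close>, and a ball that is good for a
  piece is good for \<open>A\<close>, because less of it lies outside the larger set.\<close>

lemma weak_density:
  fixes M :: "'a measure"
  assumes sets: "sets M = sets borel" and fin: "\<And>x r. emeasure M (cball x r) < \<infinity>"
    and A: "A \<in> sets borel" and "e > 0"
  shows "AE x in M. x \<in> A \<longrightarrow> (\<exists>r>0. measure M (cball x r - A) < e * measure M (cball x r))"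
proof -
  fix z :: 'a
  let ?A = "\<lambda>n. A \<inter> cball z (real n)"
  have "AE x in M. x \<in> ?A n \<longrightarrow> (\<exists>r>0. measure M (cball x r - ?A n) < e * measure M (cball x r))" for n
    using A \<open>e > 0\<close> by (intro weak_density_bounded sets fin) (auto intro: bounded_subset)
  then have "AE x in M. \<forall>n. x \<in> ?A n \<longrightarrow>
      (\<exists>r>0. measure M (cball x r - ?A n) < e * measure M (cball x r))"
    by (simp add: AE_all_countable)
  then show ?thesis
  proof eventually_elim
    case (elim x)
    show ?case
    proof
      assume "x \<in> A"
      obtain n where "dist z x \<le> real n" using real_arch_simple by blast
      with elim \<open>x \<in> A\<close> obtain r where
        r: "r > 0" "measure M (cball x r - ?A n) < e * measure M (cball x r)" by auto
      have "cball x r \<in> fmeasurable M" using sets fin[of x r] by (simp add: fmeasurable_def)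
      then have "cball x r - ?A n \<in> fmeasurable M"
        by (rule fmeasurableI2) (use A sets in auto)
      then have "measure M (cball x r - A) \<le> measure M (cball x r - ?A n)"
        by (intro measure_mono_fmeasurable) (use A sets in auto)
      then show "\<exists>r>0. measure M (cball x r - A) < e * measure M (cball x r)" using r by force
    qed
  qed
qed

section \<open>From density to the maximal function\<close>

text \<open>If the inequality fails at \<open>x\<close>, two numbers \<open>c < b\<close> fit
  strictly between the two sides. A ball in which \<open>A b\<close> has proportion at least
  \<open>c / b\<close> gives \<open>\<bar>f\<bar>\<close> an average of at least \<open>c\<close>,
  which exceeds the maximal function.\<close>

lemma maximal_function_ge_borel:
  fixes M :: "'a measure"
  assumes sets: "sets M = sets borel" and fin: "\<And>x r. emeasure M (cball x r) < \<infinity>"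
    and f: "f \<in> borel_measurable M"
  shows "AE x in M. maximal_function M f x \<ge> ennreal \<bar>f x\<bar>"
proof -
  define A where "A b = {x. b < \<bar>f x\<bar>}" for b
  have sp: "space M = UNIV" using sets_eq_imp_space_eq[OF sets] by simp
  have A: "A b \<in> sets M" for b
    using measurable_sets[OF borel_measurable_abs[OF f], of "{b<..}"] sp by (simp add: A_def vimage_def)
  \<comment> \<open>Rational levels leave only countably many exceptional null sets to
    unite.\<close>
  have "AE x in M. \<forall>c\<in>\<rat>. \<forall>b\<in>\<rat>. 0 < c \<and> c < b \<longrightarrow> x \<in> A b \<longrightarrow>
      (\<exists>r>0. measure M (cball x r - A b) < (1 - c / b) * measure M (cball x r))"
    using A sets by (intro AE_ball_countable' countable_rat AE_impI weak_density sets fin) auto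
  then show ?thesis
  proof eventually_elim
    case (elim x)
    show ?case
    proof (rule ccontr)
      assume less: "\<not> ?thesis"
      then obtain m where m: "maximal_function M f x = ennreal m" "m \<ge> 0"
        by (cases "maximal_function M f x") auto
      with less have "m < \<bar>f x\<bar>" by (simp add: not_le ennreal_less_iff)
      then obtain b where b: "b \<in> \<rat>" "m < b" "b < \<bar>f x\<bar>" using Rats_dense_in_real by blast
      then obtain c where c: "c \<in> \<rat>" "m < c" "c < b" using Rats_dense_in_real by blast
      moreover have "x \<in> A b" "0 < c" using b c m by (auto simp: A_def)
      ultimately obtain r where
        r: "r > 0" "measure M (cball x r - A b) < (1 - c / b) * measure M (cball x r)"
        using elim b(1) by blast
      let ?B = "cball x r"
      have B: "?B \<in> fmeasurable M" using fin[of x r] sets by (auto simp: fmeasurable_def)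
      then have BA: "?B \<inter> A b \<in> fmeasurable M" "?B - A b \<in> fmeasurable M"
        using A by (auto intro: fmeasurableI2[OF B])
      \<comment> \<open>The strict inequality in \<open>r(2)\<close> forces the ball to have
        positive measure, so it takes part in the supremum.\<close>
      have "0 < (1 - c / b) * measure M ?B" using r(2) measure_nonneg[of M] le_less_trans by blast
      then have pos: "measure M ?B > 0" using c m by (auto simp: zero_less_mult_iff)
      have "measure M ?B = measure M (?B \<inter> A b) + measure M (?B - A b)"
        using measure_Un2[OF BA(1) B] by (simp add: Un_absorb1 Diff_Int)
      with r(2) have "c / b * measure M ?B \<le> measure M (?B \<inter> A b)" by (simp add: algebra_simps)
      then have "c * measure M ?B \<le> b * measure M (?B \<inter> A b)"
        using c m by (simp add: field_simps)
      then have "ennreal (c * measure M ?B) \<le> ennreal b * emeasure M (?B \<inter> A b)"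
        using c m BA by (simp add: emeasure_eq_measure2 ennreal_mult[symmetric] ennreal_leI)
      also have "\<dots> = (\<integral>\<^sup>+y. ennreal b * indicator (?B \<inter> A b) y \<partial>M)"
        using BA by (simp add: nn_integral_cmult_indicator)
      also have "\<dots> \<le> (\<integral>\<^sup>+y\<in>?B. ennreal \<bar>f y\<bar> \<partial>M)"
        by (intro nn_integral_mono) (auto simp: A_def indicator_def intro: ennreal_leI)
      finally have "ennreal (c * measure M ?B) / emeasure M ?B
          \<le> (\<integral>\<^sup>+y\<in>?B. ennreal \<bar>f y\<bar> \<partial>M) / emeasure M ?B"
        by (rule divide_right_mono_ennreal)
      also have "\<dots> \<le> maximal_function M f x"
        unfolding maximal_function_def using r(1) pos B
        by (intro SUP_upper) (auto simp: emeasure_eq_measure2)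
      also have "ennreal (c * measure M ?B) / emeasure M ?B = ennreal c"
        using pos B c m by (simp add: emeasure_eq_measure2 divide_ennreal)
      finally show False using m c by simp
    qed
  qed
qed

end

section \<open>Passage to the completed measure\<close>

text \<open>Only measures of balls and integrals over balls enter, and neither is affected by
  completing or by changes on a null set. So the two functions agree at every point.\<close>

lemma maximal_function_completion:
  fixes N :: "'a::metric_space measure"
  assumes sets: "sets N = sets borel" and ae: "AE x in N. f x = g x"
  shows "maximal_function (completion N) f = maximal_function N g"
proof -
  have cb: "cball x r \<in> sets N" for x :: 'a and r using sets by simp
  have "(\<integral>\<^sup>+y\<in>cball x r. ennreal \<bar>f y\<bar> \<partial>completion N) = (\<integral>\<^sup>+y\<in>cball x r. ennreal \<bar>g y\<bar> \<partial>N)" for x r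
  proof -
    have "AE y in completion N. f y = g y" using ae by (rule AE_completion)
    then have "(\<integral>\<^sup>+y\<in>cball x r. ennreal \<bar>f y\<bar> \<partial>completion N)
        = (\<integral>\<^sup>+y\<in>cball x r. ennreal \<bar>g y\<bar> \<partial>completion N)"
      by (intro nn_integral_cong_AE) auto
    then show ?thesis by (simp add: nn_integral_completion)
  qed
  then show ?thesis using cb by (auto simp: maximal_function_def fun_eq_iff)
qed

theorem corollary4p4:
  fixes M :: "'a::metric_space measure" and f :: "'a \<Rightarrow> real"
  assumes "metric_measure_space M"
    and "geometrically_doubling TYPE('a)"
    and "locally_integrable M f"
  shows "AE x in M. maximal_function M f x \<ge> ennreal \<bar>f x\<bar>"
proof -
  obtain D where D: "\<And>(x::'a) r. r > 0 \<Longrightarrow>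
      \<exists>C. finite C \<and> card C \<le> D \<and> cball x r \<subseteq> (\<Union>y\<in>C. cball y (r / 2))"
    using assms(2) unfolding geometrically_doubling_def by blast
  obtain N where N: "sets N = sets borel" "M = N \<or> M = completion N"
    and finM: "\<And>x r. emeasure M (cball x r) < \<infinity>"
    using assms(1) unfolding metric_measure_space_def by auto
  have f: "f \<in> borel_measurable M" using assms(3) by (simp add: locally_integrable_def)
  have fin: "emeasure N (cball x r) < \<infinity>" for x r
    using N finM[of x r] by auto
  from N(2) show ?thesis
  proof
    assume "M = N"
    then show ?thesis using maximal_function_ge_borel[OF D N(1) fin] f by blast
  next
    assume M: "M = completion N"
    \<comment> \<open>A function measurable for the completion has a Borel version, to which the
      Borel case applies.\<close>
    obtain g where g: "g \<in> borel_measurable N" "AE x in N. f x = g x"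
      using completion_ex_borel_measurable_real[OF f[unfolded M]] by (elim bexE)
    have "AE x in N. maximal_function N g x \<ge> ennreal \<bar>g x\<bar>"
      using maximal_function_ge_borel[OF D N(1) fin g(1)] .
    with g(2) have "AE x in N. maximal_function M f x \<ge> ennreal \<bar>f x\<bar>"
      unfolding M maximal_function_completion[OF N(1) g(2)] by eventually_elim simp
    then show ?thesis unfolding M by (rule AE_completion)
  qed
qed

end
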